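(* Let $G=(V,E)$ be an undirected graph on $n$ vertices with weight matrix $W$ and weighted Laplacian $L$, let $2\le k\le n-1$ be an integer dividing $n$, and let $\mathbf m=\frac nk\mathbf 1_k$. Then the quadratic matrix program (for the $k$-equipartition problem) $$\min\;\tfrac12\langle L,PP^\top\rangle\quad\text{s.t.}\quad P\mathbf 1_k=\mathbf 1_n,\quad P^\top\mathbf 1_n=\mathbf m,\quad P\in\{0,1\}^{n\times k}$$ is equivalent to the binary semidefinite program $$\min\;\tfrac12\langle L,X\rangle\quad\text{s.t.}\quad \operatorname{diag}(X)=\mathbf 1_n,\quad X\mathbf 1_n=\tfrac nk\mathbf 1_n,\quad kX-\mathbf J_n\succeq\mathbf 0,\quad X\in\mathcal S^n,\quad X\in\{0,1\}^{n\times n}.$$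
   Context: $W=(w_{ij})\in\mathcal S^n$ is a real symmetric weight matrix with $w_{ij}=0$ if $\{i,j\}\notin E$, and $L=\operatorname{Diag}(W\mathbf 1_n)-W$, where $\operatorname{Diag}(v)$ is the diagonal matrix with diagonal $v$. $\mathcal S^n$ is the set of real symmetric $n\times n$ matrices; $\mathbf 1_n$ is the all-ones vector; $\mathbf J_n$ is the all-ones $n\times n$ matrix; $\langle X,Y\rangle=\operatorname{tr}(X^\top Y)$; $\succeq\mathbf 0$ means positive semidefinite; $\operatorname{diag}(X)$ is the vector of diagonal entries. Two optimization problems are called equivalent if every feasible solution of either one yields a feasible solution of the other with the same objective value. *)

theory Defs
  imports "HOL-Analysis.Analysis"
begin

text \<open>Vertices are the elements of a finite type \<open>'n\<close>, so that \<open>n = CARD('n)\<close>; partition classes are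
  the elements of a finite type \<open>'k\<close>. Loops are not excluded, as \<open>{u, v}\<close> may have \<open>u = v\<close>; they
  contribute nothing to the Laplacian.\<close>

definition undirected_graph :: "'v set \<Rightarrow> 'v set set \<Rightarrow> bool" where
  "undirected_graph V E \<longleftrightarrow> E \<subseteq> {{u, v} |u v. u \<in> V \<and> v \<in> V}"

text \<open>In \<open>HOL-Analysis\<close> the constant \<open>1\<close> on matrices is the all-ones matrix and \<open>mat 1\<close> the identity.
  The all-ones objects are spelled out here to avoid confusion.\<close>

definition ones_vec :: "real ^ 'n" where
  "ones_vec = (\<chi> i. 1)"

definition ones_mat :: "real ^ 'n ^ 'n" where
  "ones_mat = (\<chi> i j. 1)"

definition Diag :: "real ^ 'n \<Rightarrow> real ^ 'n ^ 'n" where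
  "Diag v = (\<chi> i j. if i = j then v $ i else 0)"

definition diag :: "real ^ 'n ^ 'n \<Rightarrow> real ^ 'n" where
  "diag X = (\<chi> i. X $ i $ i)"

definition sym_mat :: "real ^ 'n ^ 'n \<Rightarrow> bool" where
  "sym_mat X \<longleftrightarrow> transpose X = X"

definition psd :: "real ^ 'n ^ 'n \<Rightarrow> bool" where
  "psd X \<longleftrightarrow> sym_mat X \<and> (\<forall>x. 0 \<le> x \<bullet> (X *v x))"

definition mat_inner :: "real ^ 'c ^ 'r \<Rightarrow> real ^ 'c ^ 'r \<Rightarrow> real" where
  "mat_inner X Y = trace (transpose X ** Y)"

definition binary_mat :: "real ^ 'c ^ 'r \<Rightarrow> bool" where
  "binary_mat X \<longleftrightarrow> (\<forall>i j. X $ i $ j \<in> {0, 1})"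

definition laplacian :: "real ^ 'n ^ 'n \<Rightarrow> real ^ 'n ^ 'n" where
  "laplacian W = Diag (W *v ones_vec) - W"

record 'a min_program =
  feasible :: "'a set"
  objective :: "'a \<Rightarrow> real"

definition equivalent_programs :: "'a min_program \<Rightarrow> 'b min_program \<Rightarrow> bool" where
  "equivalent_programs p q \<longleftrightarrow>
     (\<forall>x \<in> feasible p. \<exists>y \<in> feasible q. objective q y = objective p x) \<and>
     (\<forall>y \<in> feasible q. \<exists>x \<in> feasible p. objective p x = objective q y)"

definition partition_qmp :: "real ^ 'n ^ 'n \<Rightarrow> real ^ 'k \<Rightarrow> (real ^ 'k ^ 'n) min_program" where
  "partition_qmp L m =
     \<lparr> feasible = {P. P *v ones_vec = ones_vec \<and> transpose P *v ones_vec = m \<and> binary_mat P},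
       objective = (\<lambda>P. 1 / 2 * mat_inner L (P ** transpose P)) \<rparr>"

definition equipartition_bsdp :: "real ^ 'n ^ 'n \<Rightarrow> nat \<Rightarrow> (real ^ 'n ^ 'n) min_program" where
  "equipartition_bsdp L k =
     \<lparr> feasible = {X. diag X = ones_vec \<and>
                      X *v ones_vec = (real CARD('n) / real k) *\<^sub>R ones_vec \<and>
                      psd (real k *\<^sub>R X - ones_mat) \<and>
                      sym_mat X \<and> binary_mat X},
       objective = (\<lambda>X. 1 / 2 * mat_inner L X) \<rparr>"

end

theory Submission
  imports Defs
begin

text \<open>A feasible \<open>P\<close> is the incidence matrix of a map from vertices to classes, and \<open>P P\<^sup>T\<close> is the
  indicator matrix of its kernel; positive semidefiniteness of \<open>k P P\<^sup>T - J\<close> is the Cauchy--Schwarz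
  inequality for \<open>P\<^sup>T x\<close> and the all-ones vector. Conversely, \<open>k X - J \<succeq> 0\<close> forces \<open>X \<succeq> 0\<close>, and a
  binary positive semidefinite matrix with unit diagonal is the indicator matrix of an equivalence
  relation: a failure of transitivity at \<open>i, j, l\<close> is refuted by the vector \<open>e\<^sub>i - e\<^sub>j + e\<^sub>l\<close>. The row
  sums make all classes have \<open>n / k\<close> elements, so there are \<open>k\<close> of them.\<close>

definition incidence_mat :: "('n \<Rightarrow> 'k) \<Rightarrow> real ^ 'k ^ 'n" where
  "incidence_mat f = (\<chi> i c. if f i = c then 1 else 0)"

lemma ones_vec_nth [simp]: "ones_vec $ i = 1"
  by (simp add: ones_vec_def)

lemma inner_ones_vec: "ones_vec \<bullet> x = (\<Sum>i\<in>UNIV. x $ i)" for x :: "real ^ 'n::finite"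
  by (simp add: inner_vec_def)

lemma matrix_vector_mult_ones_vec_nth: "(A *v ones_vec) $ i = (\<Sum>j\<in>UNIV. A $ i $ j)"
  for A :: "real ^ 'm::finite ^ 'n"
  by (simp add: matrix_vector_mult_def)

lemma sym_mat_iff: "sym_mat X \<longleftrightarrow> (\<forall>i j. X $ i $ j = X $ j $ i)"
  unfolding sym_mat_def transpose_def vec_eq_iff by auto

lemma sum_if_one: "(\<Sum>j\<in>UNIV. if Q j then 1 else 0 :: real) = real (card {j. Q j})"
  for Q :: "'n::finite \<Rightarrow> bool"
  by (simp add: sum.If_cases)

lemma binary_mat_nth: "binary_mat X \<Longrightarrow> X $ i $ j = (if X $ i $ j = 1 then 1 else 0)"
  by (auto simp: binary_mat_def)

text \<open>Turns real row-sum constraints into cardinalities; it serves the rows of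
  \<open>P\<close> as well as those of \<open>X\<close>.\<close>

lemma binary_mat_row_sum:
  fixes X :: "real ^ 'm::finite ^ 'n"
  assumes "binary_mat X"
  shows "(X *v ones_vec) $ i = real (card {j. X $ i $ j = 1})"
  unfolding matrix_vector_mult_ones_vec_nth sum_if_one[symmetric]
  using binary_mat_nth[OF assms] by (rule sum.cong[OF refl])

text \<open>A binary row with sum 1 has exactly one entry 1, and the column of that entry is the
  class assigned to the row.\<close>

lemma binary_mat_stochastic_iff:
  fixes P :: "real ^ 'k::finite ^ 'n::finite"
  shows "binary_mat P \<and> P *v ones_vec = ones_vec \<longleftrightarrow> (\<exists>f. P = incidence_mat f)"
proof
  assume asm: "binary_mat P \<and> P *v ones_vec = ones_vec"
  have "\<exists>c. {c. P $ i $ c = 1} = {c}" for i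
  proof -
    have "real (card {c. P $ i $ c = 1}) = 1"
      using asm binary_mat_row_sum[of P i] by simp
    then show ?thesis
      by (simp add: card_1_singleton_iff)
  qed
  then obtain f where f: "\<And>i. {c. P $ i $ c = 1} = {f i}"
    by metis
  have "P = incidence_mat f"
    unfolding incidence_mat_def vec_eq_iff
    using asm f by (fastforce simp: binary_mat_def set_eq_iff)
  then show "\<exists>f. P = incidence_mat f"
    by blast
next
  assume "\<exists>f. P = incidence_mat f"
  then show "binary_mat P \<and> P *v ones_vec = ones_vec"
    by (auto simp: binary_mat_def incidence_mat_def vec_eq_iff matrix_vector_mult_ones_vec_nth)
qed

lemma incidence_mat_gram:
  "incidence_mat f ** transpose (incidence_mat f) = (\<chi> i j. if f i = f j then 1 else 0)"
  for f :: "'n::finite \<Rightarrow> 'k::finite"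
  by (auto simp: incidence_mat_def matrix_matrix_mult_def transpose_def vec_eq_iff if_distrib
      cong: if_cong intro!: sum.neutral)

lemma inner_ones_mat: "x \<bullet> (ones_mat *v x) = (ones_vec \<bullet> x)\<^sup>2" for x :: "real ^ 'n::finite"
proof -
  have "ones_mat *v x = (ones_vec \<bullet> x) *\<^sub>R ones_vec"
    by (simp add: vec_eq_iff ones_mat_def matrix_vector_mult_def inner_ones_vec)
  then show ?thesis
    by (simp add: power2_eq_square inner_commute)
qed

text \<open>Since the all-ones matrix has rank one, semidefiniteness of
  \<open>c *\<^sub>R X - ones_mat\<close> becomes a bound on a squared coordinate sum. Both
  directions of the equivalence use it in this form.\<close>

lemma inner_scaled_minus_ones_mat:
  "x \<bullet> ((c *\<^sub>R X - ones_mat) *v x) = c * (x \<bullet> (X *v x)) - (ones_vec \<bullet> x)\<^sup>2"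
  for X :: "real ^ 'n::finite ^ 'n"
  by (simp add: matrix_vector_mult_diff_rdistrib inner_diff_right inner_ones_mat
      flip: scaleR_matrix_vector_assoc)

lemma psd_scaled_gram_minus_ones_mat:
  fixes P :: "real ^ 'k::finite ^ 'n::finite"
  assumes "P *v ones_vec = ones_vec"
  shows "psd (real CARD('k) *\<^sub>R (P ** transpose P) - ones_mat)"
  unfolding psd_def
proof (intro conjI allI)
  show "sym_mat (real CARD('k) *\<^sub>R (P ** transpose P) - ones_mat)"
    by (simp add: sym_mat_iff ones_mat_def matrix_matrix_mult_def transpose_def mult.commute)
  fix x :: "real ^ 'n"
  define s where "s = transpose P *v x"
  have "x \<bullet> ((P ** transpose P) *v x) = s \<bullet> s"
    by (simp add: s_def flip: matrix_vector_mul_assoc dot_lmul_matrix)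
  \<comment> \<open>Moving \<open>P\<close> across the inner product turns \<open>ones_vec\<close>
    on classes into \<open>P *v ones_vec\<close>, which is \<open>ones_vec\<close> on
    vertices.\<close>
  moreover have "ones_vec \<bullet> x = ones_vec \<bullet> s"
    by (metis assms dot_lmul_matrix inner_commute s_def transpose_matrix_vector)
  \<comment> \<open>The factor \<open>CARD('k)\<close> is the squared norm of
    \<open>ones_vec\<close> in the space indexed by classes.\<close>
  moreover have "(ones_vec \<bullet> s)\<^sup>2 \<le> real CARD('k) * (s \<bullet> s)"
    using Cauchy_Schwarz_ineq[of ones_vec s] by (simp add: inner_ones_vec[of ones_vec])
  ultimately show "0 \<le> x \<bullet> ((real CARD('k) *\<^sub>R (P ** transpose P) - ones_mat) *v x)"
    by (simp add: inner_scaled_minus_ones_mat)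
qed

lemma binary_psd_trans:
  fixes X :: "real ^ 'n::finite ^ 'n"
  assumes psd: "\<And>x. 0 \<le> x \<bullet> (X *v x)" and sym: "sym_mat X" and bin: "binary_mat X"
    and diag: "diag X = ones_vec"
    and ij: "X $ i $ j = 1" and jl: "X $ j $ l = 1"
  shows "X $ i $ l = 1"
proof (rule ccontr)
  assume "X $ i $ l \<noteq> 1"
  with bin have il: "X $ i $ l = 0"
    by (auto simp: binary_mat_def)
  have d: "X $ a $ a = 1" for a
    using diag by (metis diag_def ones_vec_nth vec_lambda_beta)
  have entry: "axis a 1 \<bullet> (X *v axis b 1) = X $ a $ b" for a b
    by (simp add: inner_axis' matrix_vector_mul_component inner_axis)
  have s: "X $ j $ i = 1" "X $ l $ j = 1" "X $ l $ i = 0"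
    using sym ij jl il by (auto simp: sym_mat_iff)
  define x where "x = axis i 1 - axis j 1 + (axis l 1 :: real ^ 'n)"
  \<comment> \<open>The three diagonal terms give 3, the pairs \<open>i, j\<close> and
    \<open>j, l\<close> give -2 each, and the pair \<open>i, l\<close> gives 0.\<close>
  have "x \<bullet> (X *v x) = -1"
    unfolding x_def
    by (simp add: matrix_vector_right_distrib matrix_vector_mult_diff_distrib inner_add_left
        inner_diff_left inner_add_right inner_diff_right entry d ij jl il s)
  with psd[of x] show False
    by simp
qed

text \<open>Classes of common size \<open>q\<close> partition \<open>CARD('k) * q\<close> elements,
  so there are \<open>CARD('k)\<close> of them and they can be labelled bijectively by
  \<open>'k\<close>.\<close>

lemma equiv_uniform_classes_kernel:
  fixes R :: "('n::finite \<times> 'n) set"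
  assumes R: "equiv UNIV R" and card: "\<And>i. card (R `` {i}) = q"
    and q: "CARD('k::finite) * q = CARD('n)"
  obtains f :: "'n \<Rightarrow> 'k::finite" where "\<And>i j. f i = f j \<longleftrightarrow> (i, j) \<in> R" "surj f"
proof -
  have "q * card (UNIV // R) = card (\<Union> (UNIV // R))"
  proof (rule card_partition)
    show "card C = q" if "C \<in> UNIV // R" for C
      using that card by (auto elim!: quotientE)
    show "C \<inter> D = {}" if "C \<in> UNIV // R" "D \<in> UNIV // R" "C \<noteq> D" for C D
      using quotient_disj[OF R] that by blast
  qed auto
  also have "\<dots> = CARD('k) * q"
    using Union_quotient[OF R] q by simp
  \<comment> \<open>Cancelling \<open>q\<close> is legitimate: it is nonzero because
    \<open>CARD('n)\<close> is positive.\<close>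
  finally have "card (UNIV // R) = CARD('k)"
    using q by (metis mult.commute mult_cancel_left mult_is_0 zero_less_card_finite less_irrefl)
  then obtain g :: "'n set \<Rightarrow> 'k" where g: "bij_betw g (UNIV // R) UNIV"
    using finite_same_card_bij[of "UNIV // R" "UNIV :: 'k set"] by auto
  show ?thesis
  proof (rule that)
    show "g (R `` {i}) = g (R `` {j}) \<longleftrightarrow> (i, j) \<in> R" for i j
      using g R by (metis bij_betw_imp_inj_on eq_equiv_class_iff inj_on_eq_iff UNIV_I quotientI)
    have "range (\<lambda>i. g (R `` {i})) = g ` (UNIV // R)"
      by (auto simp: quotient_def)
    then show "surj (\<lambda>i. g (R `` {i}))"
      using g by (simp add: bij_betw_def)
  qed
qed

lemma qmp_feasible_imp_bsdp_feasible:
  fixes P :: "real ^ 'k::finite ^ 'n::finite"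
  assumes "P *v ones_vec = ones_vec" "binary_mat P"
    and "transpose P *v ones_vec = (real CARD('n) / real CARD('k)) *\<^sub>R ones_vec"
  shows "P ** transpose P \<in> feasible (equipartition_bsdp L CARD('k))"
proof -
  obtain f where f: "P = incidence_mat f"
    using assms binary_mat_stochastic_iff by blast
  have "diag (P ** transpose P) = ones_vec" "sym_mat (P ** transpose P)"
    "binary_mat (P ** transpose P)"
    unfolding f incidence_mat_gram by (auto simp: diag_def vec_eq_iff sym_mat_iff binary_mat_def)
  \<comment> \<open>The column sums of \<open>P\<close> evaluate the inner product with
    \<open>transpose P\<close>, then its row sums evaluate the outer one.\<close>
  moreover have "(P ** transpose P) *v ones_vec = (real CARD('n) / real CARD('k)) *\<^sub>R ones_vec"
    unfolding matrix_vector_mul_assoc[symmetric] assms(3)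
    by (simp add: matrix_vector_mult_scaleR assms(1))
  ultimately show ?thesis
    using psd_scaled_gram_minus_ones_mat[OF assms(1)] by (simp add: equipartition_bsdp_def)
qed

lemma bsdp_feasible_imp_gram:
  fixes X :: "real ^ 'n::finite ^ 'n"
  assumes X: "X \<in> feasible (equipartition_bsdp L CARD('k::finite))"
    and dvd: "CARD('k) dvd CARD('n)"
  obtains P :: "real ^ 'k::finite ^ 'n" where "P *v ones_vec = ones_vec" "binary_mat P"
    "transpose P *v ones_vec = (real CARD('n) / real CARD('k)) *\<^sub>R ones_vec"
    "P ** transpose P = X"
proof -
  have diag: "diag X = ones_vec" and sym: "sym_mat X" and bin: "binary_mat X"
    and row: "X *v ones_vec = (real CARD('n) / real CARD('k)) *\<^sub>R ones_vec"
    and psd: "psd (real CARD('k) *\<^sub>R X - ones_mat)"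
    using X by (auto simp: equipartition_bsdp_def)
  \<comment> \<open>The quadratic form of \<open>X\<close>, scaled by \<open>CARD('k)\<close>,
    dominates a square.\<close>
  have X_psd: "0 \<le> x \<bullet> (X *v x)" for x
  proof -
    have "(ones_vec \<bullet> x)\<^sup>2 \<le> real CARD('k) * (x \<bullet> (X *v x))"
      using psd by (simp add: psd_def inner_scaled_minus_ones_mat)
    then have "0 \<le> real CARD('k) * (x \<bullet> (X *v x))"
      by (rule order_trans[OF zero_le_power2])
    then show ?thesis
      by (simp add: zero_le_mult_iff)
  qed
  define R where "R = {(i, j). X $ i $ j = 1}"
  have "equiv UNIV R"
  proof (rule equivI)
    show "refl R"
      using diag by (auto simp: refl_on_def R_def diag_def vec_eq_iff)
    show "sym R"
      using sym by (auto simp: R_def sym_def sym_mat_iff)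
    show "trans R"
      using binary_psd_trans[OF X_psd sym bin diag] by (auto simp: R_def intro: transI)
  qed auto
  \<comment> \<open>Divisibility makes the prescribed row sum a natural number, the common class
    size.\<close>
  obtain q where q: "CARD('k) * q = CARD('n)"
    using dvd by (metis dvd_def)
  then have nk: "real CARD('n) / real CARD('k) = real q"
    by (simp add: field_simps flip: of_nat_mult)
  have card_R: "card (R `` {i}) = q" for i
  proof -
    have "real (card {j. X $ i $ j = 1}) = real q"
      using row nk binary_mat_row_sum[OF bin, of i] by simp
    then show ?thesis
      by (simp add: R_def Image_def)
  qed
  obtain f :: "'n \<Rightarrow> 'k" where f: "\<And>i j. f i = f j \<longleftrightarrow> (i, j) \<in> R" "surj f"
    using equiv_uniform_classes_kernel[OF \<open>equiv UNIV R\<close> card_R q] by blast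
  show ?thesis
  proof (rule that[of "incidence_mat f"])
    show "incidence_mat f *v ones_vec = ones_vec" "binary_mat (incidence_mat f)"
      using binary_mat_stochastic_iff[of "incidence_mat f"] by blast+
    show "incidence_mat f ** transpose (incidence_mat f) = X"
      unfolding incidence_mat_gram using bin by (auto simp: vec_eq_iff f(1) R_def binary_mat_def)
    \<comment> \<open>A column sum counts the vertices labelled \<open>c\<close>. Surjectivity of
      \<open>f\<close> supplies such a vertex, so these vertices form a whole class of
      \<open>R\<close>.\<close>
    have "(transpose (incidence_mat f) *v ones_vec) $ c = real q" for c
    proof -
      obtain i where i: "f i = c"
        using \<open>surj f\<close> by (metis surjD)
      have "{j. f j = c} = R `` {i}"
        using i by (auto simp flip: f(1))
      then show ?thesis
        unfolding matrix_vector_mult_ones_vec_nth transpose_def incidence_mat_def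
        using card_R[of i] by (simp add: sum_if_one)
    qed
    then show "transpose (incidence_mat f) *v ones_vec
        = (real CARD('n) / real CARD('k)) *\<^sub>R ones_vec"
      unfolding nk by (simp add: vec_eq_iff)
  qed
qed

text \<open>The first objective depends on \<open>P\<close> only through
  \<open>P ** transpose P\<close>, where it agrees with the second. Hence it suffices that this
  product maps feasible points to feasible points and reaches every feasible
  \<open>X\<close>.\<close>

theorem proposition7:
  fixes E :: "'n::finite set set"
    and W L :: "real ^ 'n ^ 'n"
    and m :: "real ^ 'k::finite"
  assumes "undirected_graph UNIV E"
    and "sym_mat W"
    and "\<forall>i j. {i, j} \<notin> E \<longrightarrow> W $ i $ j = 0"
    and "L = laplacian W"
    and "2 \<le> CARD('k)"
    and "CARD('k) \<le> CARD('n) - 1"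
    and "CARD('k) dvd CARD('n)"
    and "m = (real CARD('n) / real CARD('k)) *\<^sub>R ones_vec"
  shows "equivalent_programs (partition_qmp L m) (equipartition_bsdp L CARD('k))"
  unfolding equivalent_programs_def
proof (intro conjI ballI)
  fix P assume "P \<in> feasible (partition_qmp L m)"
  then have "P ** transpose P \<in> feasible (equipartition_bsdp L CARD('k))"
    using assms(8) by (auto simp: partition_qmp_def intro: qmp_feasible_imp_bsdp_feasible)
  then show "\<exists>X \<in> feasible (equipartition_bsdp L CARD('k)).
      objective (equipartition_bsdp L CARD('k)) X = objective (partition_qmp L m) P"
    by (rule bexI[rotated]) (simp add: partition_qmp_def equipartition_bsdp_def)
next
  fix X assume "X \<in> feasible (equipartition_bsdp L CARD('k))"
  then obtain P :: "real ^ 'k ^ 'n" where "P *v ones_vec = ones_vec" "binary_mat P"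
    "transpose P *v ones_vec = m" "P ** transpose P = X"
    using bsdp_feasible_imp_gram assms(7,8) by metis
  then show "\<exists>P \<in> feasible (partition_qmp L m).
      objective (partition_qmp L m) P = objective (equipartition_bsdp L CARD('k)) X"
    by (intro bexI[of _ P]) (simp_all add: partition_qmp_def equipartition_bsdp_def)
qed

end
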